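(* Let $X$ be a measurable space, let $n\ge 1$, and for each $i\in\{1,\dots,n\}$ let $A_i\subseteq X$ be a measurable subset and $P_i$ a probability measure on $A_i$. Suppose that there exists a measurable set $E\subseteq\bigcap_{i=1}^n A_i$ such that $P_i(E)>0$ for every $i\in\{1,\dots,n\}$, and that $P_i|_{A_i\cap A_j}=P_j|_{A_i\cap A_j}$ for all $i,j\in\{1,\dots,n\}$. Then there exists a unique probability measure $P$ on $A:=\bigcup_{i=1}^n A_i$ such that $P|_{A_i}=P_i$ for every $i\in\{1,\dots,n\}$.
   Context: Each measurable subset $A\subseteq X$ is regarded as a measurable space whose $\sigma$-algebra consists of the measurable subsets of $X$ contained in $A$. Restriction of probability measures means conditionalization: if $P$ is a probability measure on $A$ and $B\subseteq A$ is a measurable subset with $P(B)>0$, then $P|_B$ is the probability measure on $B$ given by $P|_B(C):=P(C)/P(B)$ for measurable $C\subseteq B$. The restriction $P|_B$ is defined only when $P(B)>0$, so an equation such as $P|_{A_i}=P_i$ includes the requirement $P(A_i)>0$. (The restrictions $P_i|_{A_i\cap A_j}$ are defined because $E\subseteq A_i\cap A_j$ and $P_i(E)>0$.) *)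

theory Defs
  imports "HOL-Probability.Probability"
begin

(* Only meaningful for measurable B with emeasure P B > 0. The definition is total, so an equation
   "restrict_prob P B = Q" does not by itself say that the restriction is defined;
   "emeasure P B > 0" has to be stated alongside it. *)
definition restrict_prob :: "'a measure \<Rightarrow> 'a set \<Rightarrow> 'a measure" where
  "restrict_prob P B = scale_measure (1 / emeasure P B) (restrict_space P B)"

lemma space_restrict_prob: "B \<in> sets P \<Longrightarrow> space (restrict_prob P B) = B"
  using sets.sets_into_space[of B P]
  by (auto simp: restrict_prob_def space_scale_measure space_restrict_space)

lemma sets_restrict_prob:
  "B \<in> sets P \<Longrightarrow> sets (restrict_prob P B) = {C \<in> sets P. C \<subseteq> B}"
  by (auto simp: restrict_prob_def sets_restrict_space_iff)

lemma emeasure_restrict_prob: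
  assumes "B \<in> sets P" "C \<in> sets P" "C \<subseteq> B"
  shows "emeasure (restrict_prob P B) C = emeasure P C / emeasure P B"
proof -
  have "B \<inter> space P \<in> sets P"
    using assms(1) by simp
  then show ?thesis
    using assms by (simp add: restrict_prob_def emeasure_restrict_space divide_ennreal_def mult.commute)
qed

lemma prob_space_restrict_prob:
  assumes "prob_space P" "B \<in> sets P" "emeasure P B > 0"
  shows "prob_space (restrict_prob P B)"
proof
  interpret prob_space P by fact
  show "emeasure (restrict_prob P B) (space (restrict_prob P B)) = 1"
    using assms ennreal_divide_self[of "emeasure P B"]
    by (simp add: space_restrict_prob emeasure_restrict_prob top.not_eq_extremum[symmetric])
qed

end

theory Submission
  imports Defs
begin

text \<open>
  Rescale each \<open>P\<^sub>i\<close> to \<open>P\<^sub>i / P\<^sub>i(E)\<close>. Compatibility makes any two rescaled measures agree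
  on \<open>A\<^sub>i \<inter> A\<^sub>j\<close>, so they glue to a finite measure on the union, whose normalization is \<open>Q\<close>.
  Conversely, any extension must equal \<open>Q(E) P\<^sub>i / P\<^sub>i(E)\<close> on \<open>A\<^sub>i\<close>; so it is a multiple of the glued
  measure, and total mass one determines the multiple.
\<close>

section \<open>Restriction and conditioning in terms of real-valued measures\<close>

lemma sets_restrict_space_measurable:
  "B \<in> sets M \<Longrightarrow> sets (restrict_space M B) = {C \<in> sets M. C \<subseteq> B}"
  using sets.sets_into_space[of B M]
  by (subst set_eq_iff) (simp add: sets_restrict_space_iff Int_absorb2 conj_commute)

text \<open>No side condition is needed, by the default values: \<open>enn2real\<close> sends
  infinity to 0, and the real \<open>inverse 0\<close> is 0, so both sides vanish at 0 and at
  infinity.\<close>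

lemma enn2real_inverse: "enn2real (inverse x) = inverse (enn2real x)"
proof (cases x)
  case (real r)
  then show ?thesis by (cases "r = 0") (simp_all add: inverse_ennreal)
qed simp

lemma measure_restrict_prob:
  assumes "B \<in> sets P" "C \<in> sets P" "C \<subseteq> B"
  shows "measure (restrict_prob P B) C = measure P C / measure P B"
  using assms by (simp add: measure_def emeasure_restrict_prob divide_ennreal_def enn2real_mult enn2real_inverse divide_inverse)

text \<open>Positivity of \<open>measure Q B\<close> makes the restriction a probability measure, so
  both sides are finite and comparing real values on each set suffices. The last hypothesis is in
  product form so that no division has to be handled when it is verified.\<close>

lemma restrict_prob_eqI:
  assumes "prob_space P" "prob_space Q" "B \<in> sets Q" "sets P = {C \<in> sets Q. C \<subseteq> B}"
    and "measure Q B > 0"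
    and "\<And>C. C \<in> sets P \<Longrightarrow> measure Q C = measure Q B * measure P C"
  shows "restrict_prob Q B = P"
proof -
  interpret P: prob_space P by fact
  interpret Q: prob_space Q by fact
  interpret R: prob_space "restrict_prob Q B"
    using assms(3,5) by (intro prob_space_restrict_prob assms(2)) (simp_all add: Q.emeasure_eq_measure)
  show ?thesis
  proof (rule measure_eqI)
    show "sets (restrict_prob Q B) = sets P"
      using assms(3,4) by (simp add: sets_restrict_prob)
    fix C assume "C \<in> sets (restrict_prob Q B)"
    then have C: "C \<in> sets Q" "C \<subseteq> B" "C \<in> sets P"
      using assms(3,4) by (simp_all add: sets_restrict_prob)
    then have "measure (restrict_prob Q B) C = measure P C"
      using assms(5) by (simp add: measure_restrict_prob[OF assms(3)] assms(6)[OF C(3)])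
    then show "emeasure (restrict_prob Q B) C = emeasure P C"
      by (simp add: R.emeasure_eq_measure P.emeasure_eq_measure)
  qed
qed

section \<open>The gluing data and a disjoint decomposition of the union\<close>

locale compatible_probs =
  fixes M :: "'a measure" and I :: "nat set" and A :: "nat \<Rightarrow> 'a set" and P :: "nat \<Rightarrow> 'a measure"
    and E :: "'a set"
  assumes finite_I: "finite I" and I_nonempty: "I \<noteq> {}"
    and A_sets: "\<And>i. i \<in> I \<Longrightarrow> A i \<in> sets M"
    and prob: "\<And>i. i \<in> I \<Longrightarrow> prob_space (P i)"
    and sets_P_restrict: "\<And>i. i \<in> I \<Longrightarrow> sets (P i) = sets (restrict_space M (A i))"
    and E_sets: "E \<in> sets M"
    and E_subset: "\<And>i. i \<in> I \<Longrightarrow> E \<subseteq> A i"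
    and E_pos: "\<And>i. i \<in> I \<Longrightarrow> emeasure (P i) E > 0"
    and compatible: "\<And>i j. i \<in> I \<Longrightarrow> j \<in> I \<Longrightarrow>
           restrict_prob (P i) (A i \<inter> A j) = restrict_prob (P j) (A i \<inter> A j)"
begin

definition "S = (\<Union>i\<in>I. A i)"

text \<open>Assigns each point of the union to the least index whose set contains it; the order on
  \<open>nat\<close> serves only to make this choice.\<close>

definition "piece i = A i - (\<Union>j\<in>I \<inter> {..<i}. A j)"

text \<open>The real-valued, not yet normalized glued measure. Using one measure on each disjoint
  piece makes additivity immediate; that the choice of measure does not matter on overlaps is proved
  later, in \<open>weight_eq\<close>.\<close>

definition "weight C = (\<Sum>i\<in>I. measure (P i) (C \<inter> piece i) / measure (P i) E)"

text \<open>The sum is \<open>weight\<close> in \<open>ennreal\<close> form, so that countable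
  additivity can be inherited from each \<open>emeasure (P i)\<close>. The outer factor normalizes
  the total mass.\<close>

definition "glued = scale_measure (ennreal (1 / weight S))
  (measure_of S (sets (restrict_space M S))
    (\<lambda>C. \<Sum>i\<in>I. ennreal (1 / measure (P i) E) * emeasure (P i) (C \<inter> piece i)))"

lemma sets_P: "i \<in> I \<Longrightarrow> sets (P i) = {C \<in> sets M. C \<subseteq> A i}"
  using sets_P_restrict A_sets by (simp add: sets_restrict_space_measurable)

lemma A_subset: "i \<in> I \<Longrightarrow> A i \<subseteq> S"
  by (auto simp: S_def)

lemma S_sets: "S \<in> sets M"
  unfolding S_def using finite_I A_sets by blast

lemma space_S: "space (restrict_space M S) = S"
  using sets.sets_into_space[OF S_sets] by (auto simp: space_restrict_space)

lemma sets_S: "sets (restrict_space M S) = {C \<in> sets M. C \<subseteq> S}"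
  by (rule sets_restrict_space_measurable[OF S_sets])

lemma piece_sets: "i \<in> I \<Longrightarrow> piece i \<in> sets M"
  unfolding piece_def by (intro sets.Diff A_sets sets.finite_UN) (use finite_I in auto)

lemma piece_subset: "piece i \<subseteq> A i"
  by (auto simp: piece_def)

lemma disjoint_pieces: "disjoint_family_on piece I"
proof -
  have "piece i \<inter> piece j = {}" if "i < j" "i \<in> I" for i j :: nat
    using that by (auto simp: piece_def)
  then show ?thesis
    unfolding disjoint_family_on_def by (metis Int_commute linorder_neqE_nat)
qed

lemma Union_pieces: "(\<Union>i\<in>I. piece i) = S"
proof
  show "S \<subseteq> (\<Union>i\<in>I. piece i)"
  proof
    fix x assume "x \<in> S"
    then have ex: "\<exists>i. i \<in> I \<and> x \<in> A i" by (auto simp: S_def)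
    \<comment> \<open>The least index of a set containing \<open>x\<close> names the piece that
      contains \<open>x\<close>.\<close>
    define k where "k = (LEAST i. i \<in> I \<and> x \<in> A i)"
    have k: "k \<in> I" "x \<in> A k"
      using LeastI_ex[OF ex] by (auto simp: k_def)
    have "x \<notin> A j" if "j \<in> I \<inter> {..<k}" for j
      using not_less_Least[of j "\<lambda>i. i \<in> I \<and> x \<in> A i"] that k(1) by (auto simp: k_def)
    with k show "x \<in> (\<Union>i\<in>I. piece i)"
      by (auto simp: piece_def)
  qed
qed (use piece_subset A_subset in blast)

lemma E_pos_measure: "i \<in> I \<Longrightarrow> measure (P i) E > 0"
  using prob[of i] E_pos[of i]
  by (simp add: finite_measure.emeasure_eq_measure prob_space_def)

text \<open>Stated for an arbitrary finite measure \<open>N\<close> because it is applied both to a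
  given \<open>P k\<close> and to a competing extension \<open>Q\<close>, which live on different
  sigma-algebras.\<close>

lemma measure_sum_pieces:
  assumes "finite_measure N" "C \<in> sets N" "C \<subseteq> S"
    and "\<And>i. i \<in> I \<Longrightarrow> C \<inter> piece i \<in> sets N"
  shows "measure N C = (\<Sum>i\<in>I. measure N (C \<inter> piece i))"
proof -
  interpret finite_measure N by fact
  have "C = (\<Union>i\<in>I. C \<inter> piece i)"
    using assms(3) Union_pieces by blast
  moreover have "disjoint_family_on (\<lambda>i. C \<inter> piece i) I"
    using disjoint_pieces unfolding disjoint_family_on_def by blast
  ultimately show ?thesis
    using finite_measure_finite_Union[of I "\<lambda>i. C \<inter> piece i"] finite_I assms(4) by auto
qed

section \<open>Agreement of the rescaled measures on overlaps, and the resulting weight\<close>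

lemma scaled_agree:
  assumes i: "i \<in> I" and j: "j \<in> I" and C: "C \<in> sets M" "C \<subseteq> A i \<inter> A j"
  shows "measure (P i) C / measure (P i) E = measure (P j) C / measure (P j) E"
proof -
  have D: "A i \<inter> A j \<in> sets M" using A_sets i j by blast
  have ratio: "measure (P i) X / measure (P i) (A i \<inter> A j) = measure (P j) X / measure (P j) (A i \<inter> A j)"
    if "X \<in> sets M" "X \<subseteq> A i \<inter> A j" for X
    using arg_cong[OF compatible[OF i j], of "\<lambda>R. measure R X"] that i j D
    by (simp add: measure_restrict_prob sets_P)
  \<comment> \<open>The overlap contains \<open>E\<close>, so it has positive mass under both
    measures; this allows the normalizing constants to be cancelled below.\<close>
  have pos: "measure (P k) (A i \<inter> A j) > 0" if "k \<in> {i, j}" for k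
  proof -
    have k: "k \<in> I" using that i j by auto
    interpret prob_space "P k" by (rule prob[OF k])
    have "measure (P k) E \<le> measure (P k) (A i \<inter> A j)"
      using that E_subset[OF i] E_subset[OF j] D k by (intro finite_measure_mono) (auto simp: sets_P)
    then show ?thesis using E_pos_measure[OF k] by linarith
  qed
  have "E \<subseteq> A i \<inter> A j" using E_subset i j by blast
  \<comment> \<open>Compatibility is used twice, for \<open>C\<close> and for \<open>E\<close>. In
    the quotient of the two equations the unknown masses of the overlap cancel, leaving the masses
    relative to \<open>E\<close>.\<close>
  from ratio[OF C] ratio[OF E_sets this] pos[of i] pos[of j] E_pos_measure[OF i] E_pos_measure[OF j]
  have "(measure (P i) C / measure (P i) (A i \<inter> A j)) / (measure (P i) E / measure (P i) (A i \<inter> A j))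
    = (measure (P j) C / measure (P j) (A i \<inter> A j)) / (measure (P j) E / measure (P j) (A i \<inter> A j))"
    by simp
  then show ?thesis
    using pos[of i] pos[of j] by simp
qed

text \<open>The part of \<open>C\<close> in piece \<open>i\<close> lies in
  \<open>A i \<inter> A k\<close>, where \<open>scaled_agree\<close> lets \<open>P k\<close> replace
  \<open>P i\<close>. The sum then involves \<open>P k\<close> alone and collapses by
  additivity.\<close>

lemma weight_eq:
  assumes k: "k \<in> I" and C: "C \<in> sets M" "C \<subseteq> A k"
  shows "weight C = measure (P k) C / measure (P k) E"
proof -
  interpret prob_space "P k" by (rule prob[OF k])
  have "weight C = (\<Sum>i\<in>I. measure (P k) (C \<inter> piece i) / measure (P k) E)"
    unfolding weight_def
  proof (rule sum.cong[OF refl], rule scaled_agree)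
    fix i assume i: "i \<in> I"
    show "C \<inter> piece i \<in> sets M" using C piece_sets[OF i] by blast
    show "C \<inter> piece i \<subseteq> A i \<inter> A k" using C piece_subset by blast
  qed (use k in auto)
  also have "\<dots> = measure (P k) C / measure (P k) E"
    unfolding sum_divide_distrib[symmetric]
    by (subst measure_sum_pieces[of "P k" C])
      (use C k piece_sets A_subset[OF k] in \<open>auto simp: sets_P intro: finite_measure_axioms\<close>)
  finally show ?thesis .
qed

lemma weight_A: "k \<in> I \<Longrightarrow> weight (A k) = 1 / measure (P k) E"
proof -
  assume k: "k \<in> I"
  interpret prob_space "P k" by (rule prob[OF k])
  have "space (P k) = A k"
    using sets_eq_imp_space_eq[OF sets_P_restrict[OF k]] sets.sets_into_space[OF A_sets[OF k]]
    by (auto simp: space_restrict_space)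
  then show ?thesis
    using weight_eq[OF k A_sets[OF k]] prob_space by simp
qed

lemma weight_nonneg: "weight C \<ge> 0"
  by (simp add: weight_def sum_nonneg)

text \<open>By monotonicity \<open>weight S\<close> is at least \<open>weight (A k)\<close>, which
  is the reciprocal of the positive number \<open>measure (P k) E\<close>.\<close>

lemma weight_S_pos: "weight S > 0"
proof -
  obtain k where k: "k \<in> I" using I_nonempty by blast
  have "measure (P i) (A k \<inter> piece i) \<le> measure (P i) (S \<inter> piece i)" if i: "i \<in> I" for i
  proof -
    interpret prob_space "P i" by (rule prob[OF i])
    show ?thesis
      using A_subset[OF k] S_sets piece_sets[OF i] piece_subset
      by (intro finite_measure_mono) (auto simp: sets_P[OF i])
  qed
  then have "weight (A k) \<le> weight S"
    unfolding weight_def by (intro sum_mono divide_right_mono) auto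
  then show ?thesis
    using weight_A[OF k] E_pos_measure[OF k] by (smt (verit) divide_pos_pos)
qed

section \<open>The glued probability measure and its restrictions\<close>

lemma sets_glued: "sets glued = sets (restrict_space M S)"
  using sets.sigma_sets_eq[of "restrict_space M S"] sets.space_closed[of "restrict_space M S"]
  by (simp add: glued_def space_S)

text \<open>\<open>measure_of\<close> returns the prescribed set function only once it is known to
  be countably additive. This is checked separately for each \<open>P i\<close> on its piece, and
  the finite sum is then exchanged with the series.\<close>

lemma emeasure_glued:
  assumes C: "C \<in> sets M" "C \<subseteq> S"
  shows "emeasure glued C = ennreal (weight C / weight S)"
proof -
  let ?f = "\<lambda>C. \<Sum>i\<in>I. ennreal (1 / measure (P i) E) * emeasure (P i) (C \<inter> piece i)"
  let ?R = "restrict_space M S"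
  have "countably_additive (sets ?R) ?f"
  proof (rule countably_additiveI)
    fix F :: "nat \<Rightarrow> 'a set"
    assume F: "range F \<subseteq> sets ?R" "disjoint_family F"
    have "(\<Sum>m. emeasure (P i) (F m \<inter> piece i)) = emeasure (P i) (\<Union> (range F) \<inter> piece i)"
      if i: "i \<in> I" for i
    proof -
      have "disjoint_family (\<lambda>m. F m \<inter> piece i)"
        using F(2) unfolding disjoint_family_on_def by blast
      moreover have "range (\<lambda>m. F m \<inter> piece i) \<subseteq> sets (P i)"
        using F(1) piece_sets[OF i] piece_subset[of i] unfolding sets_S sets_P[OF i] by blast
      ultimately show ?thesis
        using suminf_emeasure[of "\<lambda>m. F m \<inter> piece i" "P i"] by simp
    qed
    then show "(\<Sum>m. ?f (F m)) = ?f (\<Union> (range F))"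
      by (subst suminf_sum) (auto intro!: summableI sum.cong)
  qed
  moreover have "positive (sets ?R) ?f" by (simp add: positive_def)
  moreover have "sigma_algebra S (sets ?R)"
    using sets.sigma_algebra_axioms[of ?R] by (simp add: space_S)
  ultimately have "emeasure (measure_of S (sets ?R) ?f) C = ?f C"
    using C sets_S by (intro emeasure_measure_of_sigma) auto
  also have "\<dots> = (\<Sum>i\<in>I. ennreal (measure (P i) (C \<inter> piece i) / measure (P i) E))"
  proof (rule sum.cong[OF refl])
    fix i assume i: "i \<in> I"
    interpret prob_space "P i" by (rule prob[OF i])
    show "ennreal (1 / measure (P i) E) * emeasure (P i) (C \<inter> piece i) =
      ennreal (measure (P i) (C \<inter> piece i) / measure (P i) E)"
      by (simp add: emeasure_eq_measure ennreal_mult[symmetric])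
  qed
  also have "\<dots> = ennreal (weight C)"
    unfolding weight_def by (rule sum_ennreal) simp
  finally show ?thesis
    using weight_S_pos by (simp add: glued_def ennreal_mult'[symmetric])
qed

lemma measure_glued:
  "C \<in> sets M \<Longrightarrow> C \<subseteq> S \<Longrightarrow> measure glued C = weight C / weight S"
  using weight_nonneg[of C] weight_nonneg[of S] by (simp add: measure_def emeasure_glued)

lemma prob_glued: "prob_space glued"
proof
  have "space glued = S"
    using sets_eq_imp_space_eq[OF sets_glued] by (simp add: space_S)
  then show "emeasure glued (space glued) = 1"
    using emeasure_glued[OF S_sets] weight_S_pos by simp
qed

text \<open>On \<open>A k\<close>, \<open>weight_eq\<close> makes the glued measure a constant
  multiple of \<open>P k\<close>, and conditioning removes the constant.\<close>

lemma restrict_glued: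
  assumes k: "k \<in> I"
  shows "emeasure glued (A k) > 0 \<and> restrict_prob glued (A k) = P k"
proof
  interpret prob_space glued by (rule prob_glued)
  have Ak: "A k \<in> sets M" "A k \<subseteq> S" using A_sets[OF k] A_subset[OF k] by auto
  have pos: "measure glued (A k) > 0"
    using measure_glued[OF Ak] weight_A[OF k] E_pos_measure[OF k] weight_S_pos by simp
  then show "emeasure glued (A k) > 0" by (simp add: emeasure_eq_measure)
  show "restrict_prob glued (A k) = P k"
  proof (rule restrict_prob_eqI[OF prob[OF k] prob_glued _ _ pos])
    show "A k \<in> sets glued" using Ak by (simp add: sets_glued sets_S)
    show "sets (P k) = {C \<in> sets glued. C \<subseteq> A k}"
      using Ak by (auto simp: sets_glued sets_S sets_P[OF k])
    fix C assume "C \<in> sets (P k)"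
    then have C: "C \<in> sets M" "C \<subseteq> A k" by (auto simp: sets_P[OF k])
    then show "measure glued C = measure glued (A k) * measure (P k) C"
      using measure_glued[of C] measure_glued[OF Ak] weight_A[OF k] weight_eq[OF k C] Ak(2) by auto
  qed
qed

section \<open>Uniqueness of the extension\<close>

lemma extension_unique:
  assumes Q: "prob_space Q" and sets_Q: "sets Q = sets (restrict_space M S)"
    and ext: "\<And>i. i \<in> I \<Longrightarrow> emeasure Q (A i) > 0 \<and> restrict_prob Q (A i) = P i"
  shows "Q = glued"
proof (rule measure_eqI)
  interpret prob_space Q by (rule Q)
  have space_Q: "space Q = S"
    using sets_eq_imp_space_eq[OF sets_Q] by (simp only: space_S)
  \<comment> \<open>Conditioning gives the factor \<open>measure Q (A i)\<close>. Comparing with the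
    same identity for \<open>E\<close> trades it for a factor involving \<open>measure Q E\<close>,
    which is common to all \<open>i\<close>.\<close>
  have on_A: "measure Q C = measure Q E * (measure (P i) C / measure (P i) E)"
    if i: "i \<in> I" and C: "C \<in> sets M" "C \<subseteq> A i" for i C
  proof -
    have cond: "measure (P i) X = measure Q X / measure Q (A i)" if "X \<in> sets M" "X \<subseteq> A i" for X
    proof -
      have "A i \<in> sets Q" "X \<in> sets Q"
        using that A_sets[OF i] A_subset[OF i] by (auto simp: sets_Q sets_S)
      then show ?thesis
        using measure_restrict_prob[of "A i" Q X] ext[OF i] that(2) by simp
    qed
    have "measure Q (A i) > 0" using ext[OF i] by (simp add: emeasure_eq_measure)
    then have "measure Q C = measure Q (A i) * measure (P i) C" "measure Q E = measure Q (A i) * measure (P i) E"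
      using cond[OF C] cond[OF E_sets E_subset[OF i]] by simp_all
    then show ?thesis using E_pos_measure[OF i] by simp
  qed
  have Q_weight: "measure Q C = measure Q E * weight C" if C: "C \<in> sets M" "C \<subseteq> S" for C
  proof -
    have "measure Q C = (\<Sum>i\<in>I. measure Q (C \<inter> piece i))"
      using C piece_sets by (intro measure_sum_pieces) (auto simp: sets_Q sets_S intro: finite_measure_axioms)
    also have "\<dots> = (\<Sum>i\<in>I. measure Q E * (measure (P i) (C \<inter> piece i) / measure (P i) E))"
      using C piece_sets piece_subset by (intro sum.cong refl on_A) auto
    finally show ?thesis by (simp add: weight_def sum_distrib_left)
  qed
  \<comment> \<open>Total mass one fixes the only remaining unknown,
    \<open>measure Q E\<close>.\<close>
  have "measure Q E * weight S = 1"
    using Q_weight[OF S_sets] prob_space by (simp add: space_Q)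
  then have norm: "measure Q E = 1 / weight S"
    using weight_S_pos by (simp add: field_simps)
  show "sets Q = sets glued" by (simp add: sets_Q sets_glued)
  fix C assume "C \<in> sets Q"
  then have "C \<in> sets M" "C \<subseteq> S" by (auto simp: sets_Q sets_S)
  then show "emeasure Q C = emeasure glued C"
    using Q_weight norm by (simp add: emeasure_eq_measure emeasure_glued)
qed

end

theorem theorem4:
  fixes M :: "'a measure" and n :: nat and A :: "nat \<Rightarrow> 'a set" and P :: "nat \<Rightarrow> 'a measure"
  assumes "n \<ge> 1"
    and "\<And>i. i \<in> {1..n} \<Longrightarrow> A i \<in> sets M"
    and "\<And>i. i \<in> {1..n} \<Longrightarrow> prob_space (P i)"
    and "\<And>i. i \<in> {1..n} \<Longrightarrow> sets (P i) = sets (restrict_space M (A i))"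
    and "\<exists>E\<in>sets M. E \<subseteq> (\<Inter>i\<in>{1..n}. A i) \<and> (\<forall>i\<in>{1..n}. emeasure (P i) E > 0)"
    and "\<And>i j. i \<in> {1..n} \<Longrightarrow> j \<in> {1..n} \<Longrightarrow>
           restrict_prob (P i) (A i \<inter> A j) = restrict_prob (P j) (A i \<inter> A j)"
  shows "\<exists>!Q. prob_space Q \<and> sets Q = sets (restrict_space M (\<Union>i\<in>{1..n}. A i)) \<and>
           (\<forall>i\<in>{1..n}. emeasure Q (A i) > 0 \<and> restrict_prob Q (A i) = P i)"
proof -
  obtain E where E: "E \<in> sets M" "E \<subseteq> (\<Inter>i\<in>{1..n}. A i)" "\<forall>i\<in>{1..n}. emeasure (P i) E > 0"
    using assms(5) by blast
  interpret compatible_probs M "{1..n}" A P E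
  proof (rule compatible_probs.intro)
    show "{1..n} \<noteq> {}" using assms(1) by simp
    show "E \<subseteq> A i" if "i \<in> {1..n}" for i using E(2) that by blast
    show "emeasure (P i) E > 0" if "i \<in> {1..n}" for i using E(3) that by blast
  qed (rule finite_atLeastAtMost E(1) assms(2-4,6); assumption)+
  have "prob_space glued \<and> sets glued = sets (restrict_space M S) \<and>
      (\<forall>i\<in>{1..n}. emeasure glued (A i) > 0 \<and> restrict_prob glued (A i) = P i)"
    by (intro conjI ballI prob_glued sets_glued) (simp_all only: restrict_glued)
  then show ?thesis
    unfolding S_def by (rule ex1I) (rule extension_unique, simp_all only: S_def)
qed

end
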